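(* Let $n\ge 2$, $d\ge 1$, let $W\in\mathbb{R}^{n\times n}$ be a weight matrix satisfying the network assumption (see context), and let $\mathsf{Q}:\mathbb{R}^d\to\mathbb{R}^d$ be a (possibly stochastic) compressor such that, for some $\delta\in[0,1)$, $\mathbb{E}[\|\mathsf{Q}(\mathbf{x})-\mathbf{x}\|^2]\le\delta\|\mathbf{x}\|^2$ for all $\mathbf{x}\in\mathbb{R}^d$. Let $\mathbf{x}_1,\dots,\mathbf{x}_n\in\mathbb{R}^d$, $\bar{\mathbf{x}}=\frac1n\sum_{i=1}^n\mathbf{x}_i$, and let $\{X^k\}_{k\ge0}$, $\{\widehat X^k\}_{k\ge0}$ in $\mathbb{R}^{n\times d}$ be generated by $$\widehat X^{k+1}=\widehat X^k+\mathsf{Q}(X^k-\widehat X^k),\qquad X^{k+1}=X^k+\gamma(W-I)\widehat X^{k+1},$$ with $X^0=[\mathbf{x}_1,\dots,\mathbf{x}_n]^{\mathsf T}$ and $\widehat X^0=0$. Let $\gamma\in\Big(0,\frac{1-\delta}{(1+\delta)(1-\lambda_n(W))}\Big)$, $q=\frac{(1+\gamma(1-\lambda_n(W)))\,\delta}{1-\gamma(1-\lambda_n(W))}$, and $$e^k=\mathbb{E}\Big(q\|X^k-\mathbf{1}\bar{\mathbf{x}}^{\mathsf T}\|^2+\|\widehat X^{k+1}-X^k\|^2\Big).$$ Then for all $k\ge 0$, $$e^{k+1}\le\sigma e^k,\qquad \sigma=\max\Big\{1-\frac{2\gamma\rho}{1+\gamma(1-\lambda_n(W))},\ \frac{\delta(1+\gamma(1-\lambda_n(W)))}{1-\gamma(1-\lambda_n(W))}\Big\}<1,$$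 where $\rho=1-\lambda_2(W)$. In particular, if $\gamma=\frac{1-\delta}{(3+\delta)(1-\lambda_n(W))}$, then $\sigma=1-\frac{(1-\delta)\rho}{2(1-\lambda_n(W))}$.
   Context: Network assumption: $\mathcal{G}=(\mathcal{V},\mathcal{E},W)$ is a connected undirected graph on $\mathcal{V}=\{1,\dots,n\}$, $[W]_{ij}=0$ whenever $i\ne j$ and $(i,j)\notin\mathcal{E}$, and (a) $W=W^{\mathsf T}$; (b) $\mathrm{null}(I-W)=\mathrm{span}(\mathbf{1}_n)$; (c) $-I\prec W\preceq I$. $\lambda_j(W)$ is the $j$-th largest eigenvalue of $W$; $\mathbf{1}$ is the all-ones vector in $\mathbb{R}^n$; $\|\cdot\|$ is the Euclidean norm for vectors and the Frobenius norm for matrices. For $X=[\mathbf{x}_1,\dots,\mathbf{x}_n]^{\mathsf T}\in\mathbb{R}^{n\times d}$, $\mathsf{Q}(X)=[\mathsf{Q}(\mathbf{x}_1),\dots,\mathsf{Q}(\mathbf{x}_n)]^{\mathsf T}$ (the compressor is applied to each row). $\mathbb{E}$ is the expectation over the randomness of $\mathsf{Q}$; the randomness used in each iteration is independent of that of previous iterations. *)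

theory Defs
  imports "HOL-Probability.Probability" "HOL-Computational_Algebra.Computational_Algebra"
begin

definition charpoly :: "real ^ 'n ^ 'n \<Rightarrow> real poly" where
  "charpoly A = det (\<chi> i j. if i = j then [:- (A $ i $ j), 1:] else [:- (A $ i $ j):])"

lemma poly_charpoly: "poly (charpoly A) t = det (t *\<^sub>R mat 1 - A)"
  unfolding charpoly_def det_def poly_sum poly_mult poly_prod of_int_poly
  by (intro sum.cong prod.cong arg_cong2[where f = "(*)"] refl) (auto simp: mat_def)

(* Eigenvalues are counted with multiplicity and the index j starts at 1.  For a symmetric A the
   list has length n, so the entries j = 1, ..., n are all meaningful. *)
definition nth_largest_eigenvalue :: "real ^ 'n ^ 'n \<Rightarrow> nat \<Rightarrow> real" where
  "nth_largest_eigenvalue A j = rev (sorted_list_of_multiset (proots (charpoly A))) ! (j - 1)"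

definition pos_semidefinite :: "real ^ 'n ^ 'n \<Rightarrow> bool" where
  "pos_semidefinite A \<longleftrightarrow> transpose A = A \<and> (\<forall>v. 0 \<le> v \<bullet> (A *v v))"

definition pos_definite :: "real ^ 'n ^ 'n \<Rightarrow> bool" where
  "pos_definite A \<longleftrightarrow> transpose A = A \<and> (\<forall>v. v \<noteq> 0 \<longrightarrow> 0 < v \<bullet> (A *v v))"

definition loewner_le :: "real ^ 'n ^ 'n \<Rightarrow> real ^ 'n ^ 'n \<Rightarrow> bool" where
  "loewner_le A B \<longleftrightarrow> pos_semidefinite (B - A)"

definition loewner_less :: "real ^ 'n ^ 'n \<Rightarrow> real ^ 'n ^ 'n \<Rightarrow> bool" where
  "loewner_less A B \<longleftrightarrow> pos_definite (B - A)"

definition null_space :: "real ^ 'n ^ 'm \<Rightarrow> (real ^ 'n) set" where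
  "null_space A = {v. A *v v = 0}"

definition connected_undirected_graph :: "('n \<times> 'n) set \<Rightarrow> bool" where
  "connected_undirected_graph E \<longleftrightarrow> sym E \<and> (\<forall>i j. (i, j) \<in> E\<^sup>*)"

(* mat 1 is the identity matrix, whereas 1 :: real ^ 'n is the all-ones vector. *)
definition network_weights :: "('n \<times> 'n) set \<Rightarrow> real ^ 'n ^ 'n \<Rightarrow> bool" where
  "network_weights E W \<longleftrightarrow>
     connected_undirected_graph E \<and>
     (\<forall>i j. i \<noteq> j \<and> (i, j) \<notin> E \<longrightarrow> W $ i $ j = 0) \<and>
     W = transpose W \<and>
     null_space (mat 1 - W) = span {1} \<and>
     loewner_less (- mat 1) W \<and> loewner_le W (mat 1)"

(* A stochastic compressor is a deterministic map Q of the input and of a random seed distributed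
   according to S; a deterministic compressor ignores the seed.  Integrability is required
   separately because the Bochner integral of a non-integrable function is 0. *)
definition compressor ::
    "'s measure \<Rightarrow> (real ^ 'd \<Rightarrow> 's \<Rightarrow> real ^ 'd) \<Rightarrow> real \<Rightarrow> bool" where
  "compressor S Q \<delta> \<longleftrightarrow>
     prob_space S \<and>
     (\<lambda>(x, s). Q x s) \<in> borel_measurable (borel \<Otimes>\<^sub>M S) \<and>
     (\<forall>x. integrable S (\<lambda>s. (norm (Q x s - x))\<^sup>2) \<and>
          (\<integral>s. (norm (Q x s - x))\<^sup>2 \<partial>S) \<le> \<delta> * (norm x)\<^sup>2)"

(* \<xi> k i is the seed used for row i in iteration k.  The families (\<xi> k i)_i are independent for
   different k; within one iteration the seeds of different rows may be arbitrarily dependent. *)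
definition iteration_seeds ::
    "'w measure \<Rightarrow> 's measure \<Rightarrow> (nat \<Rightarrow> 'n \<Rightarrow> 'w \<Rightarrow> 's) \<Rightarrow> bool" where
  "iteration_seeds M S \<xi> \<longleftrightarrow>
     prob_space M \<and>
     (\<forall>k i. \<xi> k i \<in> measurable M S \<and> distr M S (\<xi> k i) = S) \<and>
     prob_space.indep_vars M (\<lambda>k. Pi\<^sub>M UNIV (\<lambda>i. S)) (\<lambda>k \<omega> i. \<xi> k i \<omega>) UNIV"

definition compress_rows ::
    "(real ^ 'd \<Rightarrow> 's \<Rightarrow> real ^ 'd) \<Rightarrow> ('n \<Rightarrow> 's) \<Rightarrow> real ^ 'd ^ 'n \<Rightarrow> real ^ 'd ^ 'n" where
  "compress_rows Q s X = (\<chi> i. Q (X $ i) (s i))"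

definition outer_product :: "real ^ 'n \<Rightarrow> real ^ 'd \<Rightarrow> real ^ 'd ^ 'n" where
  "outer_product u v = (\<chi> i j. u $ i * v $ j)"

(* On real ^ 'd ^ 'n the library norm is the Frobenius norm. *)

end

theory Submission
  imports Defs
begin

text \<open>
  Why the error contracts. Put \<open>T Y = \<gamma> *\<^sub>R ((mat 1 - W) ** Y)\<close> and \<open>\<tau> = \<gamma> * (1 - lamn)\<close>, and let
  \<open>D\<close> be the disagreement \<open>X k - outer_product 1 xbar\<close> and \<open>H = Xhat (Suc k) - X k\<close> the compression
  error. The map \<open>T\<close> is self-adjoint with spectrum in the interval from 0 to \<open>\<tau> < 1\<close> and annihilates
  the consensus matrix, so the next disagreement is \<open>D - T (D + H)\<close> and, up to its sign, the next
  input of the compressor is \<open>H + T (D + H)\<close>. That input depends on past seeds only; the fresh seeds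
  are independent of it, and compressing it leaves an expected squared error of at most \<open>\<delta>\<close> times its
  expected squared norm (\<open>recursive_state_indep_next_input\<close>, \<open>compress_rows_mean_square_error\<close>).

  The claim is thereby reduced to a pointwise inequality for
  \<open>q * (norm (D - T (D + H)))\<^sup>2 + \<delta> * (norm (H + T (D + H)))\<^sup>2\<close>. With
  \<open>q = (1 + \<tau>) * \<delta> / (1 - \<tau>)\<close> and the bound \<open>(norm (T v))\<^sup>2 \<le> \<tau> * (T v \<bullet> v)\<close> its mixed terms cancel,
  and it is at most \<open>q * (1 - 2 * \<gamma> * \<rho> / (1 + \<tau>)) * (norm D)\<^sup>2 + q * (norm H)\<^sup>2\<close>
  (\<open>lyapunov_step\<close>). Relative to the error \<open>q * (norm D)\<^sup>2 + (norm H)\<^sup>2\<close> the two factors are precisely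
  the two arguments of the maximum \<open>\<sigma>\<close>. The factor at \<open>D\<close> uses that the iteration conserves the row
  average: the columns of \<open>D\<close> are orthogonal to the all-ones vector, where \<open>T\<close> is at least \<open>\<gamma> * \<rho>\<close>.

  The ordered roots of the characteristic polynomial enter through these spectral bounds only. They
  are identified with Rayleigh quotients by means of an orthonormal eigenbasis of \<open>W\<close> that contains
  the normalised all-ones vector (\<open>selfadjoint_eigenbasis\<close>, \<open>charpoly_eigenbasis\<close>,
  \<open>network_matrix_spectrum\<close>).
\<close>

section \<open>Eigenbases of self-adjoint maps\<close>

text \<open>
  Expand the nonnegative number \<open>T (s *\<^sub>R v - T v) \<bullet> (s *\<^sub>R v - T v)\<close> and choose \<open>s = \<tau>\<close>. The
  conclusion says that \<open>T * (\<tau> - T)\<close> is positive semidefinite on \<open>U\<close>. The version on an invariant subspace \<open>U\<close> produces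
  eigenvectors below; with \<open>U = UNIV\<close> it is the decisive inequality of the Lyapunov argument.
\<close>

lemma psd_norm_sq_le:
  fixes T :: "'a::real_inner \<Rightarrow> 'a"
  assumes "linear T" and "subspace U" and inv: "\<And>v. v \<in> U \<Longrightarrow> T v \<in> U"
    and selfadjoint: "\<And>v w. v \<in> U \<Longrightarrow> w \<in> U \<Longrightarrow> T v \<bullet> w = v \<bullet> T w"
    and nonneg: "\<And>v. v \<in> U \<Longrightarrow> 0 \<le> T v \<bullet> v"
    and upper: "\<And>v. v \<in> U \<Longrightarrow> T v \<bullet> v \<le> \<tau> * (norm v)\<^sup>2"
    and "v \<in> U"
  shows "(norm (T v))\<^sup>2 \<le> \<tau> * (T v \<bullet> v)"
proof (cases "v = 0")
  case True
  then show ?thesis using linear_0[OF \<open>linear T\<close>] by simp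
next
  case False
  define w where "w = T v"
  have w: "w \<in> U" using inv \<open>v \<in> U\<close> w_def by simp
  have "0 \<le> \<tau> * (norm v)\<^sup>2" using nonneg[OF \<open>v \<in> U\<close>] upper[OF \<open>v \<in> U\<close>] by linarith
  then have \<tau>: "0 \<le> \<tau>" using False by (simp add: zero_le_mult_iff)
  have key: "2 * s * (norm w)\<^sup>2 \<le> s\<^sup>2 * (T v \<bullet> v) + \<tau> * (norm w)\<^sup>2" for s
  proof -
    have "s *\<^sub>R v - w \<in> U" using \<open>subspace U\<close> \<open>v \<in> U\<close> w by (simp add: subspace_diff subspace_scale)
    then have "0 \<le> T (s *\<^sub>R v - w) \<bullet> (s *\<^sub>R v - w)" by (rule nonneg)
    also have "\<dots> = s\<^sup>2 * (T v \<bullet> v) - 2 * s * (norm w)\<^sup>2 + T w \<bullet> w"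
      using selfadjoint[OF w \<open>v \<in> U\<close>]
      by (simp add: linear_diff[OF \<open>linear T\<close>] linear_cmul[OF \<open>linear T\<close>] inner_diff_left inner_diff_right
          w_def[symmetric] dot_square_norm[symmetric] algebra_simps) (simp add: power2_eq_square)
    finally show ?thesis using upper[OF w] by linarith
  qed
  show ?thesis
  proof (cases "\<tau> = 0")
    case True
    \<comment> \<open>For \<open>\<tau> = 0\<close> the choice \<open>s = \<tau>\<close> says nothing, but the quadratic form vanishes and \<open>s = 1\<close> works.\<close>
    then have "T v \<bullet> v = 0" using nonneg upper \<open>v \<in> U\<close> by (simp add: order_antisym)
    then show ?thesis using key[of 1] True by (simp add: w_def)
  next
    case False
    have "\<tau> * (norm w)\<^sup>2 \<le> \<tau> * (\<tau> * (T v \<bullet> v))"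
      using key[of \<tau>] by (simp add: power2_eq_square algebra_simps)
    then show ?thesis using False \<tau> by (simp add: w_def)
  qed
qed

text \<open>
  A maximiser \<open>u\<close> of the Rayleigh quotient on the unit sphere of \<open>U\<close> is an eigenvector: the map
  \<open>g v = (f u \<bullet> u) *\<^sub>R v - f v\<close> is then positive semidefinite on \<open>U\<close> with \<open>g u \<bullet> u = 0\<close>, and the
  preceding lemma forces \<open>g u = 0\<close>.
\<close>

lemma selfadjoint_eigenvector:
  fixes f :: "'a::euclidean_space \<Rightarrow> 'a"
  assumes "linear f" and "subspace U" and inv: "\<And>v. v \<in> U \<Longrightarrow> f v \<in> U"
    and sa: "\<And>v w. f v \<bullet> w = v \<bullet> f w" and "U \<noteq> {0}"
  obtains u where "u \<in> U" "norm u = 1" "f u = (f u \<bullet> u) *\<^sub>R u"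
proof -
  let ?K = "sphere 0 1 \<inter> U"
  have cont: "continuous_on ?K (\<lambda>v. f v \<bullet> v)"
    using linear_continuous_on[of f] \<open>linear f\<close>
    by (intro continuous_on_inner continuous_on_id) (simp add: linear_conv_bounded_linear)
  have "compact ?K" using closed_subspace[OF \<open>subspace U\<close>] by (simp add: compact_Int_closed)
  moreover obtain z where z: "z \<in> U" "z \<noteq> 0"
    using \<open>U \<noteq> {0}\<close> subspace_0[OF \<open>subspace U\<close>] by auto
  moreover have "z /\<^sub>R norm z \<in> ?K" using z subspace_scale[OF \<open>subspace U\<close>] by simp
  ultimately obtain u where u: "u \<in> ?K" and umax: "\<And>v. v \<in> ?K \<Longrightarrow> f v \<bullet> v \<le> f u \<bullet> u"
    using continuous_attains_sup[OF _ _ cont] by (metis empty_iff)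
  define g where "g = (\<lambda>v. (f u \<bullet> u) *\<^sub>R v - f v)"
  have lin: "linear g" unfolding g_def
    by (intro linear_compose_sub linear_scaleR \<open>linear f\<close>) 
  have nonneg: "0 \<le> g v \<bullet> v" if "v \<in> U" for v
  proof (cases "v = 0")
    case False
    have "v /\<^sub>R norm v \<in> ?K" using False that subspace_scale[OF \<open>subspace U\<close>] by simp
    from umax[OF this] have "(f v \<bullet> v) / (norm v)\<^sup>2 \<le> f u \<bullet> u"
      by (simp add: linear_cmul[OF \<open>linear f\<close>] power2_eq_square field_simps)
    then show ?thesis using False
      by (simp add: g_def inner_diff_left power2_norm_eq_inner[symmetric] field_simps)
  qed simp
  obtain C where C: "\<And>v. norm (g v) \<le> norm v * C"
    using bounded_linear.bounded[of g] lin linear_conv_bounded_linear by metis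
  have upper: "g v \<bullet> v \<le> C * (norm v)\<^sup>2" for v
    using norm_cauchy_schwarz[of "g v" v] mult_right_mono[OF C[of v] norm_ge_zero[of v]]
    by (simp add: power2_eq_square algebra_simps)
  have "(norm (g u))\<^sup>2 \<le> C * (g u \<bullet> u)"
    by (rule psd_norm_sq_le[OF lin \<open>subspace U\<close> _ _ nonneg upper])
      (use u inv sa \<open>subspace U\<close> in \<open>auto simp: g_def inner_diff_left inner_diff_right subspace_diff subspace_scale\<close>)
  also have "g u \<bullet> u = 0" using u by (simp add: g_def inner_diff_left norm_eq_1)
  finally have "f u = (f u \<bullet> u) *\<^sub>R u" by (simp add: g_def)
  then show ?thesis using u that by auto
qed

text \<open>
  The spectral theorem, by splitting off one eigenvector at a time: its orthogonal complement inside
  \<open>U\<close> is again invariant. Having an arbitrary invariant \<open>U\<close> instead of the whole space allows the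
  basis to be adapted to the decomposition into consensus and disagreement directions.
\<close>

lemma selfadjoint_eigenbasis:
  fixes f :: "'a::euclidean_space \<Rightarrow> 'a"
  assumes "linear f" and sa: "\<And>v w. f v \<bullet> w = v \<bullet> f w"
    and "subspace U" and "\<And>v. v \<in> U \<Longrightarrow> f v \<in> U"
  obtains B where "finite B" "B \<subseteq> U" "pairwise orthogonal B" "\<And>b. b \<in> B \<Longrightarrow> norm b = 1"
    "\<And>b. b \<in> B \<Longrightarrow> f b = (f b \<bullet> b) *\<^sub>R b" "U \<subseteq> span B"
proof -
  have "\<exists>B. finite B \<and> B \<subseteq> U \<and> pairwise orthogonal B \<and> (\<forall>b\<in>B. norm b = 1)
      \<and> (\<forall>b\<in>B. f b = (f b \<bullet> b) *\<^sub>R b) \<and> U \<subseteq> span B"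
    using \<open>subspace U\<close> \<open>\<And>v. v \<in> U \<Longrightarrow> f v \<in> U\<close>
  proof (induction "dim U" arbitrary: U rule: less_induct)
    case less
    show ?case
    proof (cases "U = {0}")
      case True
      then show ?thesis by (intro exI[of _ "{}"]) auto
    next
      case False
      then obtain u where u: "u \<in> U" "norm u = 1" "f u = (f u \<bullet> u) *\<^sub>R u"
        using selfadjoint_eigenvector[OF \<open>linear f\<close> less.prems sa] by metis
      define V where "V = U \<inter> {w. u \<bullet> w = 0}"
      have V: "subspace V" unfolding V_def
        using less.prems(1) subspace_hyperplane by (rule subspace_inter)
      have inv: "f v \<in> V" if "v \<in> V" for v
      proof -
        have "u \<bullet> f v = f u \<bullet> v" by (simp add: sa)
        also have "\<dots> = (f u \<bullet> u) * (u \<bullet> v)" using u(3) by (metis inner_scaleR_left)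
        finally show ?thesis using that less.prems(2) by (simp add: V_def)
      qed
      have "u \<notin> V" using u by (auto simp: V_def norm_eq_1)
      then have "V \<subset> U" using u(1) unfolding V_def by blast
      then have "dim V < dim U"
        using V less.prems(1) by (metis dim_psubset span_eq_iff)
      from less.hyps[OF this V inv] obtain B where
        B: "finite B" "B \<subseteq> V" "pairwise orthogonal B" "\<forall>b\<in>B. norm b = 1"
          "\<forall>b\<in>B. f b = (f b \<bullet> b) *\<^sub>R b" "V \<subseteq> span B" by blast
      have "U \<subseteq> span (insert u B)"
      proof
        fix v assume "v \<in> U"
        then have "v - (v \<bullet> u) *\<^sub>R u \<in> V"
          using u less.prems(1)
          by (auto simp: V_def subspace_diff subspace_scale inner_diff_right norm_eq_1 inner_commute)
        then have "v - (v \<bullet> u) *\<^sub>R u \<in> span B" using B by auto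
        then show "v \<in> span (insert u B)" using span_breakdown_eq by blast
      qed
      moreover have "pairwise orthogonal (insert u B)"
        using B(2,3) by (auto simp: pairwise_insert V_def orthogonal_def inner_commute)
      ultimately show ?thesis using B u
        by (intro exI[of _ "insert u B"]) (auto simp: V_def)
    qed
  qed
  then show ?thesis using that by blast
qed

lemma orthonormal_expansion_inner:
  fixes f :: "'a::euclidean_space \<Rightarrow> 'a"
  assumes "linear f" "finite B" "pairwise orthogonal B" "\<And>b. b \<in> B \<Longrightarrow> norm b = 1"
    and eig: "\<And>b. b \<in> B \<Longrightarrow> f b = \<mu> b *\<^sub>R b" and "v \<in> span B"
  shows "f v \<bullet> v = (\<Sum>b\<in>B. \<mu> b * (v \<bullet> b)\<^sup>2)"
proof -
  have v: "(\<Sum>b\<in>B. (v \<bullet> b) *\<^sub>R b) = v"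
    by (rule orthonormal_basis_expand) (use assms in auto)
  have "f v = (\<Sum>b\<in>B. ((v \<bullet> b) * \<mu> b) *\<^sub>R b)"
    by (subst v[symmetric]) (simp add: linear_sum[OF \<open>linear f\<close>] linear_cmul[OF \<open>linear f\<close>] eig)
  then show ?thesis
    by (simp add: inner_sum_left inner_sum_right power2_eq_square inner_commute[of v] mult_ac)
qed

text \<open>
  Eigenvalues are given as roots of the characteristic polynomial, counted with multiplicity, whereas
  the estimates need Rayleigh quotients. The bridge is diagonalisation: conjugating \<open>t - A\<close> by the
  matrix \<open>P\<close> with the basis vectors as columns turns its determinant into a product over the basis.
\<close>

lemma charpoly_eigenbasis:
  fixes A :: "real ^ 'n ^ 'n"
  assumes "finite B" "pairwise orthogonal B" and n1: "\<And>b. b \<in> B \<Longrightarrow> norm b = 1"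
    and "span B = UNIV" and eig: "\<And>b. b \<in> B \<Longrightarrow> A *v b = \<mu> b *\<^sub>R b"
  shows "charpoly A = (\<Prod>b\<in>B. [:- \<mu> b, 1:])"
proof -
  have "0 \<notin> B" using n1 by force
  then have "independent B" using assms pairwise_orthogonal_independent by blast
  then have "card B = CARD('n)"
    using \<open>span B = UNIV\<close> by (metis dim_UNIV dim_span dim_eq_card_independent DIM_cart DIM_real mult_1_right)
  then obtain h where h: "bij_betw h (UNIV :: 'n set) B"
    using \<open>finite B\<close> by (metis finite_same_card_bij finite_code)
  have hB: "h j \<in> B" for j using h by (auto simp: bij_betw_def)
  define P :: "real ^ 'n ^ 'n" where "P = (\<chi> i j. h j $ i)"
  have col: "column j P = h j" for j by (simp add: P_def column_def)
  have "h i \<bullet> h j = (if i = j then 1 else 0)" for i j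
    using pairwiseD[OF \<open>pairwise orthogonal B\<close> hB[of i] hB[of j]] n1[OF hB] bij_betw_imp_inj_on[OF h]
    by (auto simp: inj_eq orthogonal_def norm_eq_1)
  then have PtP: "transpose P ** P = mat 1"
    by (simp add: matrix_mult_transpose_dot_column col mat_def vec_eq_iff)
  have "poly (charpoly A) t = poly (\<Prod>b\<in>B. [:- \<mu> b, 1:]) t" for t
  proof -
    let ?M = "t *\<^sub>R mat 1 - A"
    let ?D = "(\<chi> i j. if i = j then t - \<mu> (h j) else 0) :: real ^ 'n ^ 'n"
    have "column j (?M ** P) = column j (P ** ?D)" for j
    proof -
      have "column j (?M ** P) = ?M *v h j"
        by (simp add: col[symmetric] vec_eq_iff column_def matrix_matrix_mult_def matrix_vector_mult_def)
      also have "\<dots> = (t - \<mu> (h j)) *\<^sub>R h j"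
        by (simp add: matrix_vector_mult_diff_rdistrib eig hB algebra_simps scaleR_matrix_vector_assoc[symmetric])
      also have "\<dots> = column j (P ** ?D)"
        by (simp add: vec_eq_iff column_def matrix_matrix_mult_def P_def if_distrib[of "\<lambda>z. _ * z"] cong: if_cong)
      finally show ?thesis .
    qed
    then have "?M ** P = P ** ?D" by (simp add: vec_eq_iff column_def)
    then have "det ?M * det P = det P * det ?D" unfolding det_mul[symmetric] by (rule arg_cong)
    moreover have "det P \<noteq> 0"
      using PtP det_mul[of "transpose P" P] by (auto simp: det_transpose)
    ultimately have "det ?M = det ?D" by simp
    also have "\<dots> = (\<Prod>i\<in>UNIV. t - \<mu> (h i))" by (subst det_diagonal) auto
    also have "\<dots> = (\<Prod>b\<in>B. t - \<mu> b)" by (rule prod.reindex_bij_betw[OF h])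
    finally show ?thesis by (simp add: poly_charpoly poly_prod)
  qed
  then show ?thesis by (simp add: poly_eq_poly_eq_iff[symmetric] fun_eq_iff)
qed

lemma proots_charpoly_eigenbasis:
  fixes A :: "real ^ 'n ^ 'n"
  assumes "finite B" "pairwise orthogonal B" "\<And>b. b \<in> B \<Longrightarrow> norm b = 1"
    and "span B = UNIV" "\<And>b. b \<in> B \<Longrightarrow> A *v b = \<mu> b *\<^sub>R b"
  shows "proots (charpoly A) = image_mset \<mu> (mset_set B)"
proof -
  have "proots (charpoly A) = (\<Sum>b\<in>B. {#\<mu> b#})"
    by (subst charpoly_eigenbasis[OF assms]) (simp_all add: proots_prod)
  also have "\<dots> = image_mset \<mu> (mset_set B)"
    using \<open>finite B\<close> by induction simp_all
  finally show ?thesis .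
qed

section \<open>The spectral gap of the weight matrix\<close>

text \<open>
  For a network matrix \<open>m = 1\<close> is the simple eigenvalue of the consensus direction and \<open>N\<close> collects
  the eigenvalues on its orthogonal complement, so that the second largest eigenvalue overall is the
  largest one in \<open>N\<close>. Positions count from 0.
\<close>

lemma second_and_last_of_sorted_with_maximum:
  fixes N :: "real multiset"
  assumes "\<And>y. y \<in># N \<Longrightarrow> y \<le> m" and "N \<noteq> {#}"
  defines "xs \<equiv> rev (sorted_list_of_multiset (add_mset m N))"
  shows "xs ! 1 \<in># N" "y \<in># N \<Longrightarrow> y \<le> xs ! 1"
    "xs ! size N \<in># N" "y \<in># N \<Longrightarrow> xs ! size N \<le> y"
proof -
  let ?L = "sorted_list_of_multiset N"
  have "sorted_list_of_multiset (add_mset m N) = ?L @ [m]"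
    by (subst sorted_list_of_multiset_insert, rule sorted_insort_is_snoc) (simp_all add: assms(1))
  then have xs: "xs = m # rev ?L" by (simp add: xs_def)
  have len: "length ?L = size N" by (metis mset_sorted_list_of_multiset size_mset)
  have ne: "?L \<noteq> []" using \<open>N \<noteq> {#}\<close> by (metis mset_sorted_list_of_multiset mset_zero_iff)
  have pos: "0 < size N" using \<open>N \<noteq> {#}\<close> by (simp add: nonempty_has_size)
  have second: "xs ! 1 = ?L ! (size N - 1)" using ne len pos by (simp add: xs rev_nth)
  have final: "xs ! size N = ?L ! 0" using len pos \<open>N \<noteq> {#}\<close> by (simp add: xs nth_Cons' rev_nth)
  show "xs ! 1 \<in># N" unfolding second using len pos
    by (metis diff_less mset_sorted_list_of_multiset nth_mem set_mset_mset zero_less_one)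
  show "xs ! size N \<in># N" unfolding final using len pos
    by (metis mset_sorted_list_of_multiset nth_mem set_mset_mset)
  have ex: "\<exists>i<size N. y = ?L ! i" if "y \<in># N"
    using that len by (metis in_set_conv_nth mset_sorted_list_of_multiset set_mset_mset)
  show "y \<le> xs ! 1" if "y \<in># N"
    using ex[OF that] len unfolding second
    by (auto intro!: sorted_nth_mono[OF sorted_sorted_list_of_multiset])
  show "xs ! size N \<le> y" if "y \<in># N"
    using ex[OF that] len unfolding final
    by (auto intro!: sorted_nth_mono[OF sorted_sorted_list_of_multiset])
qed

lemma symmetric_matrix_selfadjoint:
  fixes A :: "real ^ 'n ^ 'n"
  assumes "transpose A = A"
  shows "(A *v v) \<bullet> w = v \<bullet> (A *v w)"
  by (metis assms dot_lmul_matrix transpose_matrix_vector)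

text \<open>
  The orthogonal complement \<open>U\<close> of the all-ones vector is invariant under \<open>W\<close>. An orthonormal
  eigenbasis \<open>B\<close> of \<open>U\<close> together with the normalised all-ones vector \<open>u\<close> diagonalises \<open>W\<close>. The
  eigenvalues on \<open>B\<close> are strictly below 1, because the eigenspace of 1 is spanned by the all-ones
  vector. Hence the second largest eigenvalue is the largest one on \<open>B\<close>, and it bounds the quadratic
  form on \<open>U\<close>.
\<close>

lemma network_matrix_spectrum:
  fixes W :: "real ^ 'n ^ 'n"
  assumes "2 \<le> CARD('n)" and sym: "transpose W = W"
    and kernel: "null_space (mat 1 - W) = span {1}" and "loewner_le W (mat 1)"
  shows "nth_largest_eigenvalue W 2 < 1"
    and "nth_largest_eigenvalue W CARD('n) \<le> nth_largest_eigenvalue W 2"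
    and "v \<bullet> 1 = 0 \<Longrightarrow> (W *v v) \<bullet> v \<le> nth_largest_eigenvalue W 2 * (norm v)\<^sup>2"
    and "nth_largest_eigenvalue W CARD('n) * (norm v)\<^sup>2 \<le> (W *v v) \<bullet> v"
proof -
  have sa: "(W *v v) \<bullet> w = v \<bullet> (W *v w)" for v w
    using sym by (rule symmetric_matrix_selfadjoint)
  have W1: "W *v 1 = 1"
  proof -
    have "(1 :: real ^ 'n) \<in> null_space (mat 1 - W)" unfolding kernel by (simp add: span_base)
    then show ?thesis by (simp add: null_space_def matrix_vector_mult_diff_rdistrib)
  qed
  define U where "U = {w :: real ^ 'n. 1 \<bullet> w = 0}"
  have "subspace U" unfolding U_def by (rule subspace_hyperplane)
  moreover have "W *v w \<in> U" if "w \<in> U" for w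
    using that sa[of 1 w] by (simp add: U_def W1)
  ultimately obtain B where B: "finite B" "B \<subseteq> U" "pairwise orthogonal B" "\<And>b. b \<in> B \<Longrightarrow> norm b = 1"
    "\<And>b. b \<in> B \<Longrightarrow> W *v b = ((W *v b) \<bullet> b) *\<^sub>R b" "U \<subseteq> span B"
    using selfadjoint_eigenbasis[of "(*v) W" U] sa by (metis matrix_vector_mul_linear)
  define u :: "real ^ 'n" where "u = 1 /\<^sub>R norm (1 :: real ^ 'n)"
  have one: "(1 :: real ^ 'n) \<noteq> 0" by (simp add: vec_eq_iff)
  have u: "norm u = 1" "W *v u = u" "u \<notin> U"
    using one by (simp_all add: u_def W1 matrix_vector_mult_scaleR U_def)
  define \<mu> where "\<mu> = (\<lambda>b. (W *v b) \<bullet> b)"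
  have full: "finite (insert u B)" "pairwise orthogonal (insert u B)"
    "\<And>b. b \<in> insert u B \<Longrightarrow> norm b = 1" "span (insert u B) = UNIV"
    "\<And>b. b \<in> insert u B \<Longrightarrow> W *v b = \<mu> b *\<^sub>R b"
  proof -
    show "finite (insert u B)" "\<And>b. b \<in> insert u B \<Longrightarrow> norm b = 1" using B u by auto
    show "pairwise orthogonal (insert u B)"
      using B(2,3) by (auto simp: pairwise_insert U_def u_def orthogonal_def inner_commute)
    show "W *v b = \<mu> b *\<^sub>R b" if "b \<in> insert u B" for b
    proof (cases "b = u")
      case True
      then show ?thesis using u by (simp add: \<mu>_def norm_eq_1)
    next
      case False
      then show ?thesis using that B(5)[of b] by (simp add: \<mu>_def)
    qed
    have "v \<in> span (insert u B)" for v
    proof -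
      have "1 \<bullet> u = norm (1 :: real ^ 'n)" using one
        by (simp add: u_def dot_square_norm power2_eq_square)
      then have "v - (1 \<bullet> v / norm (1 :: real ^ 'n)) *\<^sub>R u \<in> U"
        using one by (simp add: U_def inner_diff_right)
      then show ?thesis using B(6) span_breakdown_eq by blast
    qed
    then show "span (insert u B) = UNIV" by blast
  qed
  have notin: "u \<notin> B" using u B by auto
  have "\<mu> u = 1" using u by (simp add: \<mu>_def norm_eq_1)
  then have roots: "proots (charpoly W) = add_mset 1 (image_mset \<mu> (mset_set B))"
    using proots_charpoly_eigenbasis[OF full] notin B(1) by simp
  have "0 \<notin> insert u B" using full(3) by force
  then have "independent (insert u B)" using full pairwise_orthogonal_independent by blast
  then have "card (insert u B) = CARD('n)"
    using full(4) by (metis dim_UNIV dim_span dim_eq_card_independent DIM_cart DIM_real mult_1_right)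
  then have card: "CARD('n) = Suc (card B)" using notin B(1) by simp
  then have ne: "B \<noteq> {}" using \<open>2 \<le> CARD('n)\<close> by auto
  have less1: "\<mu> b < 1" if "b \<in> B" for b
  proof -
    have "0 \<le> b \<bullet> ((mat 1 - W) *v b)"
      using \<open>loewner_le W (mat 1)\<close> by (simp add: loewner_le_def pos_semidefinite_def)
    then have le: "\<mu> b \<le> 1" using B(4)[OF that]
      by (simp add: matrix_vector_mult_diff_rdistrib inner_diff_right \<mu>_def inner_commute norm_eq_1)
    have "\<mu> b \<noteq> 1"
    proof
      assume "\<mu> b = 1"
      then have "b \<in> null_space (mat 1 - W)"
        using B(5)[OF that] by (simp add: \<mu>_def null_space_def matrix_vector_mult_diff_rdistrib)
      then obtain c where c: "b = c *\<^sub>R 1" unfolding kernel by (auto simp: span_singleton)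
      have "1 \<bullet> b = 0" using B(2) that by (auto simp: U_def)
      then show False using c B(4)[OF that] one by simp
    qed
    then show ?thesis using le by simp
  qed
  let ?N = "image_mset \<mu> (mset_set B)"
  have mem: "y \<in># ?N \<longleftrightarrow> y \<in> \<mu> ` B" for y using B(1) by simp
  have size: "size ?N = card B" by simp
  have "\<And>y. y \<in># ?N \<Longrightarrow> y \<le> 1" using less1 mem by (auto intro: less_imp_le)
  moreover have "?N \<noteq> {#}" using ne B(1) by (simp add: mset_set_empty_iff)
  ultimately have
    second: "nth_largest_eigenvalue W 2 \<in> \<mu> ` B" "\<And>b. b \<in> B \<Longrightarrow> \<mu> b \<le> nth_largest_eigenvalue W 2" and
    last: "nth_largest_eigenvalue W CARD('n) \<in> \<mu> ` B"
      "\<And>b. b \<in> B \<Longrightarrow> nth_largest_eigenvalue W CARD('n) \<le> \<mu> b"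
    using second_and_last_of_sorted_with_maximum[of ?N 1] mem
    unfolding nth_largest_eigenvalue_def roots card size by auto
  show less: "nth_largest_eigenvalue W 2 < 1" using second(1) less1 by auto
  show le: "nth_largest_eigenvalue W CARD('n) \<le> nth_largest_eigenvalue W 2" using second last by auto
  have lin: "linear ((*v) W)" "linear (\<lambda>v :: real ^ 'n. v)" by (simp_all add: linear_id[unfolded id_def])
  show "(W *v v) \<bullet> v \<le> nth_largest_eigenvalue W 2 * (norm v)\<^sup>2" if "v \<bullet> 1 = 0"
  proof -
    have v: "v \<in> span B" using B(6) that by (auto simp: U_def inner_commute)
    have "(W *v v) \<bullet> v = (\<Sum>b\<in>B. \<mu> b * (v \<bullet> b)\<^sup>2)"
      using orthonormal_expansion_inner[OF lin(1) B(1,3,4) _ v] full(5) by blast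
    also have "\<dots> \<le> (\<Sum>b\<in>B. nth_largest_eigenvalue W 2 * (v \<bullet> b)\<^sup>2)"
      by (intro sum_mono mult_right_mono second) simp_all
    also have "\<dots> = nth_largest_eigenvalue W 2 * (v \<bullet> v)"
      using orthonormal_expansion_inner[OF lin(2) B(1,3,4) _ v, of "\<lambda>_. 1"] by (simp add: sum_distrib_left)
    finally show ?thesis by (simp add: power2_norm_eq_inner)
  qed
  show "nth_largest_eigenvalue W CARD('n) * (norm v)\<^sup>2 \<le> (W *v v) \<bullet> v"
  proof -
    have v: "v \<in> span (insert u B)" using full(4) by simp
    have "nth_largest_eigenvalue W CARD('n) * (norm v)\<^sup>2
        = (\<Sum>b\<in>insert u B. nth_largest_eigenvalue W CARD('n) * (v \<bullet> b)\<^sup>2)"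
      using orthonormal_expansion_inner[OF lin(2) full(1-3) _ v, of "\<lambda>_. 1"]
      by (simp only: sum_distrib_left[symmetric] power2_norm_eq_inner) simp
    also have "\<dots> \<le> (\<Sum>b\<in>insert u B. \<mu> b * (v \<bullet> b)\<^sup>2)"
      using last(2) less le \<open>\<mu> u = 1\<close> by (intro sum_mono mult_right_mono) auto
    also have "\<dots> = (W *v v) \<bullet> v"
      using orthonormal_expansion_inner[OF lin(1) full(1-3) full(5) v] by simp
    finally show ?thesis .
  qed
qed

section \<open>Matrices as tuples of columns\<close>

text \<open>
  Left multiplication by a matrix acts on each column separately, and the Frobenius inner product is
  the sum of the inner products of the columns. This carries spectral bounds over to matrices.
\<close>

lemma inner_matrix_columns:
  fixes Y Z :: "real ^ 'd ^ 'n"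
  shows "Y \<bullet> Z = (\<Sum>j\<in>UNIV. column j Y \<bullet> column j Z)"
  unfolding inner_vec_def column_def by (simp add: sum.swap[of _ "UNIV :: 'n set"])

lemma column_matrix_mult: "column j (A ** Y) = A *v column j Y"
  by (simp add: vec_eq_iff column_def matrix_matrix_mult_def matrix_vector_mult_def)

lemma norm_matrix_columns: "(norm (Y :: real ^ 'd ^ 'n))\<^sup>2 = (\<Sum>j\<in>UNIV. (norm (column j Y))\<^sup>2)"
  unfolding power2_norm_eq_inner by (rule inner_matrix_columns)

lemma outer_product_one_column: "column j (outer_product 1 v) = (v $ j) *\<^sub>R 1"
  by (simp add: vec_eq_iff column_def outer_product_def)

lemma linear_matrix_mult: "linear (\<lambda>Y :: real ^ 'd ^ 'n. (A :: real ^ 'n ^ 'm) ** Y)"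
  by (rule linearI)
    (simp_all add: vec_eq_iff matrix_matrix_mult_def sum.distrib sum_distrib_left algebra_simps)

lemma column_scaleR: "column j (c *\<^sub>R Y) = c *\<^sub>R column j Y"
  by (simp add: vec_eq_iff column_def)

lemma network_quadratic_form_bounds:
  fixes W :: "real ^ 'n ^ 'n" and Y Z :: "real ^ 'd ^ 'n"
  assumes "2 \<le> CARD('n)" and sym: "transpose W = W"
    and "null_space (mat 1 - W) = span {1}" and "loewner_le W (mat 1)"
  shows "((mat 1 - W) ** Y) \<bullet> Z = Y \<bullet> ((mat 1 - W) ** Z)"
    and "0 \<le> ((mat 1 - W) ** Y) \<bullet> Y"
    and "((mat 1 - W) ** Y) \<bullet> Y \<le> (1 - nth_largest_eigenvalue W CARD('n)) * (norm Y)\<^sup>2"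
    and "(\<And>j. column j Y \<bullet> 1 = 0) \<Longrightarrow>
      (1 - nth_largest_eigenvalue W 2) * (norm Y)\<^sup>2 \<le> ((mat 1 - W) ** Y) \<bullet> Y"
proof -
  note spectrum = network_matrix_spectrum[OF assms]
  have sa: "((mat 1 - W) *v v) \<bullet> w = v \<bullet> ((mat 1 - W) *v w)" for v w
    by (simp add: matrix_vector_mult_diff_rdistrib inner_diff_left inner_diff_right
        symmetric_matrix_selfadjoint[OF sym])
  have form: "((mat 1 - W) *v v) \<bullet> v = (norm v)\<^sup>2 - (W *v v) \<bullet> v" for v
    by (simp add: matrix_vector_mult_diff_rdistrib inner_diff_left power2_norm_eq_inner)
  show "((mat 1 - W) ** Y) \<bullet> Z = Y \<bullet> ((mat 1 - W) ** Z)"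
    by (simp add: inner_matrix_columns column_matrix_mult sa)
  show "0 \<le> ((mat 1 - W) ** Y) \<bullet> Y"
    using \<open>loewner_le W (mat 1)\<close>
    by (auto simp: inner_matrix_columns column_matrix_mult sa loewner_le_def pos_semidefinite_def
        intro!: sum_nonneg)
  show "((mat 1 - W) ** Y) \<bullet> Y \<le> (1 - nth_largest_eigenvalue W CARD('n)) * (norm Y)\<^sup>2"
    unfolding inner_matrix_columns column_matrix_mult norm_matrix_columns sum_distrib_left form
    using spectrum(4) by (intro sum_mono) (simp add: algebra_simps)
  show "(1 - nth_largest_eigenvalue W 2) * (norm Y)\<^sup>2 \<le> ((mat 1 - W) ** Y) \<bullet> Y"
    if "\<And>j. column j Y \<bullet> 1 = 0"
    unfolding inner_matrix_columns column_matrix_mult norm_matrix_columns sum_distrib_left form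
    using spectrum(3)[OF that] by (intro sum_mono) (simp add: algebra_simps)
qed

section \<open>The Lyapunov inequality\<close>

text \<open>
  The deterministic core. With \<open>s = \<delta> / (1 - \<tau>)\<close> the two weights are \<open>q = s * (1 + \<tau>)\<close> and
  \<open>\<delta> = s * (1 - \<tau>)\<close>, and both norms on the left contain the term \<open>N = (norm (T (D + H)))\<^sup>2\<close>, which
  therefore occurs with total weight \<open>2 * s\<close>. Bounding it by \<open>\<tau> * (T (D + H) \<bullet> (D + H))\<close> makes the
  mixed terms \<open>T D \<bullet> H\<close> cancel exactly; this is what singles out the ratio of \<open>q\<close> and \<open>\<delta>\<close>. What
  remains is \<open>s\<close> times \<open>(1 + \<tau>) * (norm D)\<^sup>2 - 2 * (T D \<bullet> D) + (1 - \<tau>) * (norm H)\<^sup>2 + 2 * (T H \<bullet> H)\<close>, where the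
  form at \<open>D\<close> is bounded below by the spectral gap and the form at \<open>H\<close> above by \<open>\<tau>\<close>.
\<close>

lemma lyapunov_step:
  fixes T :: "'a::real_inner \<Rightarrow> 'a"
  assumes "linear T" and sa: "\<And>v w. T v \<bullet> w = v \<bullet> T w"
    and nonneg: "\<And>v. 0 \<le> T v \<bullet> v" and upper: "\<And>v. T v \<bullet> v \<le> \<tau> * (norm v)\<^sup>2"
    and gap: "\<mu> * (norm D)\<^sup>2 \<le> T D \<bullet> D"
    and "0 \<le> \<tau>" "\<tau> < 1" "0 \<le> \<delta>"
  defines "q \<equiv> (1 + \<tau>) * \<delta> / (1 - \<tau>)"
  shows "q * (norm (D - T (D + H)))\<^sup>2 + \<delta> * (norm (H + T (D + H)))\<^sup>2
    \<le> q * (1 - 2 * \<mu> / (1 + \<tau>)) * (norm D)\<^sup>2 + q * (norm H)\<^sup>2"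
proof -
  define s where "s = \<delta> / (1 - \<tau>)"
  have s: "0 \<le> s" "q = s * (1 + \<tau>)" "\<delta> = s * (1 - \<tau>)"
    using \<open>0 \<le> \<tau>\<close> \<open>\<tau> < 1\<close> \<open>0 \<le> \<delta>\<close> by (simp_all add: s_def q_def)
  define N where "N = (norm (T (D + H)))\<^sup>2"
  have sum: "T (D + H) = T D + T H" by (simp add: linear_add[OF \<open>linear T\<close>])
  have N: "N \<le> \<tau> * (T D \<bullet> D + 2 * (T D \<bullet> H) + T H \<bullet> H)"
  proof -
    have "N \<le> \<tau> * (T (D + H) \<bullet> (D + H))" unfolding N_def
      by (rule psd_norm_sq_le[of T UNIV]) (use assms in auto)
    also have "T (D + H) \<bullet> (D + H) = T D \<bullet> D + 2 * (T D \<bullet> H) + T H \<bullet> H"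
      using sa[of H D] by (simp add: sum inner_add_left inner_add_right inner_commute)
    finally show ?thesis .
  qed
  have d: "(norm (D - T (D + H)))\<^sup>2 = (norm D)\<^sup>2 - 2 * (T D \<bullet> D + T D \<bullet> H) + N"
  proof -
    have "D \<bullet> T (D + H) = T D \<bullet> D + T D \<bullet> H" using sa[of D "D + H"] by (simp add: inner_add_right)
    then show ?thesis unfolding N_def power2_norm_eq_inner
      by (simp add: inner_diff_left inner_diff_right inner_commute)
  qed
  have h: "(norm (H + T (D + H)))\<^sup>2 = (norm H)\<^sup>2 + 2 * (T D \<bullet> H + T H \<bullet> H) + N"
  proof -
    have "H \<bullet> T (D + H) = T D \<bullet> H + T H \<bullet> H" by (simp add: sum inner_add_right inner_commute)
    then show ?thesis unfolding N_def power2_norm_eq_inner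
      by (simp add: inner_add_left[of H] inner_add_right[of _ H] inner_commute)
  qed
  have "(1 + \<tau>) * (norm (D - T (D + H)))\<^sup>2 + (1 - \<tau>) * (norm (H + T (D + H)))\<^sup>2
      \<le> (1 + \<tau> - 2 * \<mu>) * (norm D)\<^sup>2 + (1 + \<tau>) * (norm H)\<^sup>2"
    unfolding d h using N gap upper[of H] by (simp add: algebra_simps)
  then have le: "s * ((1 + \<tau>) * (norm (D - T (D + H)))\<^sup>2 + (1 - \<tau>) * (norm (H + T (D + H)))\<^sup>2)
      \<le> s * ((1 + \<tau> - 2 * \<mu>) * (norm D)\<^sup>2 + (1 + \<tau>) * (norm H)\<^sup>2)"
    using s(1) by (rule mult_left_mono)
  have q: "q * (1 - 2 * \<mu> / (1 + \<tau>)) = s * (1 + \<tau> - 2 * \<mu>)"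
    using \<open>0 \<le> \<tau>\<close> by (simp add: s(2) field_simps)
  show ?thesis
    unfolding q unfolding s(2,3) using le by (simp add: algebra_simps)
qed

section \<open>Square-integrable random vectors\<close>

text \<open>
  All iterates belong to this class: it is closed under the linear operations of the algorithm, and
  compression preserves it (shown below). Without it the expectations would not be additive.
\<close>

definition square_integrable :: "'w measure \<Rightarrow> ('w \<Rightarrow> 'a::euclidean_space) \<Rightarrow> bool" where
  "square_integrable M f \<longleftrightarrow> f \<in> borel_measurable M \<and> integrable M (\<lambda>\<omega>. (norm (f \<omega>))\<^sup>2)"

lemma square_integrable_cong:
  "(\<And>\<omega>. \<omega> \<in> space M \<Longrightarrow> f \<omega> = g \<omega>) \<Longrightarrow> square_integrable M f \<longleftrightarrow> square_integrable M g"
  unfolding square_integrable_def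
  by (intro conj_cong measurable_cong Bochner_Integration.integrable_cong) auto

lemma square_integrable_add:
  assumes "square_integrable M f" "square_integrable M g"
  shows "square_integrable M (\<lambda>\<omega>. f \<omega> + g \<omega>)"
  unfolding square_integrable_def
proof
  show meas: "(\<lambda>\<omega>. f \<omega> + g \<omega>) \<in> borel_measurable M"
    using assms by (auto simp: square_integrable_def)
  show "integrable M (\<lambda>\<omega>. (norm (f \<omega> + g \<omega>))\<^sup>2)"
  proof (rule Bochner_Integration.integrable_bound)
    show "integrable M (\<lambda>\<omega>. 2 * (norm (f \<omega>))\<^sup>2 + 2 * (norm (g \<omega>))\<^sup>2)"
      using assms by (auto simp: square_integrable_def)
    have "(norm (f \<omega> + g \<omega>))\<^sup>2 \<le> 2 * (norm (f \<omega>))\<^sup>2 + 2 * (norm (g \<omega>))\<^sup>2" for \<omega>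
    proof -
      have "(norm (f \<omega> + g \<omega>))\<^sup>2 + (norm (f \<omega> - g \<omega>))\<^sup>2 = 2 * (norm (f \<omega>))\<^sup>2 + 2 * (norm (g \<omega>))\<^sup>2"
        unfolding power2_norm_eq_inner by (simp add: inner_add inner_diff inner_commute)
      then show ?thesis using zero_le_power2[of "norm (f \<omega> - g \<omega>)"] by linarith
    qed
    then show "AE \<omega> in M. norm ((norm (f \<omega> + g \<omega>))\<^sup>2) \<le> norm (2 * (norm (f \<omega>))\<^sup>2 + 2 * (norm (g \<omega>))\<^sup>2)"
      by (intro AE_I2) (simp add: abs_of_nonneg)
  qed (use meas in measurable)
qed

lemma square_integrable_linear:
  assumes "linear L" "square_integrable M f"
  shows "square_integrable M (\<lambda>\<omega>. L (f \<omega>))"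
proof -
  have bl: "bounded_linear L" using \<open>linear L\<close> by (simp add: linear_conv_bounded_linear)
  obtain C where C: "\<And>y. norm (L y) \<le> norm y * C" using bounded_linear.bounded[OF bl] by blast
  have "L \<in> borel_measurable borel"
    using bl by (intro borel_measurable_continuous_onI linear_continuous_on)
  then have meas: "(\<lambda>\<omega>. L (f \<omega>)) \<in> borel_measurable M"
    using assms(2) by (auto simp: square_integrable_def)
  have "integrable M (\<lambda>\<omega>. (norm (L (f \<omega>)))\<^sup>2)"
  proof (rule Bochner_Integration.integrable_bound)
    show "integrable M (\<lambda>\<omega>. (norm (f \<omega>))\<^sup>2 * C\<^sup>2)"
      using assms(2) by (simp add: square_integrable_def)
    show "AE \<omega> in M. norm ((norm (L (f \<omega>)))\<^sup>2) \<le> norm ((norm (f \<omega>))\<^sup>2 * C\<^sup>2)"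
      using power_mono[OF C norm_ge_zero, of _ 2] by (intro AE_I2) (simp add: power_mult_distrib)
  qed (use meas in measurable)
  then show ?thesis using meas by (simp add: square_integrable_def)
qed

lemma square_integrable_diff:
  assumes "square_integrable M f" "square_integrable M g"
  shows "square_integrable M (\<lambda>\<omega>. f \<omega> - g \<omega>)"
  using square_integrable_add[OF assms(1) square_integrable_linear[OF _ assms(2), of uminus]]
  by (simp add: linear_uminus)

lemma (in prob_space) square_integrable_const: "square_integrable M (\<lambda>_. c)"
  by (simp add: square_integrable_def)

lemma borel_measurable_vec_nth: "(\<lambda>v :: 'a::euclidean_space ^ 'n. v $ i) \<in> borel_measurable borel"
  by (intro borel_measurable_continuous_onI linear_continuous_on bounded_linear_vec_nth)

lemma borel_measurable_vec_lambda:
  fixes f :: "'n::finite \<Rightarrow> 'w \<Rightarrow> 'a::euclidean_space"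
  assumes "\<And>i. f i \<in> borel_measurable M"
  shows "(\<lambda>\<omega>. \<chi> i. f i \<omega>) \<in> borel_measurable M"
proof (subst borel_measurable_euclidean_space, intro ballI)
  fix b :: "'a ^ 'n" assume "b \<in> Basis"
  then obtain i u where "b = axis i u" by (auto simp: Basis_vec_def)
  then show "(\<lambda>\<omega>. (\<chi> i. f i \<omega>) \<bullet> b) \<in> borel_measurable M"
    using assms[of i] by (simp add: inner_axis)
qed

section \<open>The mean square error of compression\<close>

text \<open>
  The joint law is the product of the marginal laws. The two random variables take values in
  different types: one is a state of the algorithm, the other a random seed.
\<close>

definition (in prob_space) independent_pair ::
    "'b measure \<Rightarrow> ('a \<Rightarrow> 'b) \<Rightarrow> 'c measure \<Rightarrow> ('a \<Rightarrow> 'c) \<Rightarrow> bool" where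
  "independent_pair N X S Y \<longleftrightarrow> X \<in> measurable M N \<and> Y \<in> measurable M S \<and>
     distr M N X \<Otimes>\<^sub>M distr M S Y = distr M (N \<Otimes>\<^sub>M S) (\<lambda>\<omega>. (X \<omega>, Y \<omega>))"

lemma (in prob_space) independent_pair_compose:
  assumes "independent_pair N X S Y" and f: "f \<in> measurable N N'" and g: "g \<in> measurable S S'"
  shows "independent_pair N' (\<lambda>\<omega>. f (X \<omega>)) S' (\<lambda>\<omega>. g (Y \<omega>))"
proof -
  have X [measurable]: "X \<in> measurable M N" and Y [measurable]: "Y \<in> measurable M S"
    and law: "distr M N X \<Otimes>\<^sub>M distr M S Y = distr M (N \<Otimes>\<^sub>M S) (\<lambda>\<omega>. (X \<omega>, Y \<omega>))"
    using assms(1) by (simp_all add: independent_pair_def)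
  note [measurable] = f g
  have gY: "distr (distr M S Y) S' g = distr M S' (\<lambda>\<omega>. g (Y \<omega>))"
    by (simp add: distr_distr comp_def)
  interpret law: prob_space "distr M S' (\<lambda>\<omega>. g (Y \<omega>))" by (rule prob_space_distr) measurable
  have "distr M N' (\<lambda>\<omega>. f (X \<omega>)) \<Otimes>\<^sub>M distr M S' (\<lambda>\<omega>. g (Y \<omega>))
      = distr (distr M N X) N' f \<Otimes>\<^sub>M distr (distr M S Y) S' g"
    by (simp add: distr_distr comp_def)
  also have "\<dots> = distr (distr M N X \<Otimes>\<^sub>M distr M S Y) (N' \<Otimes>\<^sub>M S') (\<lambda>(x, y). (f x, g y))"
    by (rule pair_measure_distr) (simp_all add: gY law.sigma_finite_measure_axioms)
  also have "\<dots> = distr M (N' \<Otimes>\<^sub>M S') (\<lambda>\<omega>. (f (X \<omega>), g (Y \<omega>)))"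
    unfolding law by (simp add: distr_distr comp_def case_prod_beta')
  finally show ?thesis by (simp add: independent_pair_def)
qed

text \<open>
  The defining inequality of a compressor concerns fixed inputs. For a random input \<open>V\<close> that is
  independent of the seed, Tonelli's theorem on the product of the two laws allows conditioning on
  \<open>V\<close>. Working with nonnegative integrals gives integrability of the error at the same time.
\<close>

lemma (in prob_space) compressor_mean_square_error:
  assumes Q: "compressor S Q \<delta>" and "0 \<le> \<delta>"
    and ind: "independent_pair borel V S Y" and Y: "distr M S Y = S" and V: "square_integrable M V"
  shows "square_integrable M (\<lambda>\<omega>. Q (V \<omega>) (Y \<omega>) - V \<omega>)"
    and "(\<integral>\<omega>. (norm (Q (V \<omega>) (Y \<omega>) - V \<omega>))\<^sup>2 \<partial>M) \<le> \<delta> * (\<integral>\<omega>. (norm (V \<omega>))\<^sup>2 \<partial>M)"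
proof -
  interpret S: prob_space S using Q by (simp add: compressor_def)
  have rv [measurable]: "V \<in> borel_measurable M" "Y \<in> measurable M S"
    using ind by (simp_all add: independent_pair_def)
  have Qm: "(\<lambda>p. Q (fst p) (snd p)) \<in> borel_measurable (borel \<Otimes>\<^sub>M S)"
    using Q by (simp add: compressor_def case_prod_beta')
  have meas: "(\<lambda>\<omega>. Q (V \<omega>) (Y \<omega>) - V \<omega>) \<in> borel_measurable M"
    using measurable_compose[OF measurable_Pair[OF rv] Qm] by simp
  define h where "h = (\<lambda>p. ennreal ((norm (Q (fst p) (snd p) - fst p))\<^sup>2))"
  have hm [measurable]: "h \<in> borel_measurable (borel \<Otimes>\<^sub>M S)"
    unfolding h_def using Qm by measurable
  have cond: "(\<integral>\<^sup>+s. h (x, s) \<partial>S) \<le> ennreal (\<delta> * (norm x)\<^sup>2)" for x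
    using Q by (simp add: h_def compressor_def nn_integral_eq_integral ennreal_leI)
  have "(\<integral>\<^sup>+\<omega>. ennreal ((norm (Q (V \<omega>) (Y \<omega>) - V \<omega>))\<^sup>2) \<partial>M)
      = (\<integral>\<^sup>+p. h p \<partial>distr M (borel \<Otimes>\<^sub>M S) (\<lambda>\<omega>. (V \<omega>, Y \<omega>)))"
    by (simp add: nn_integral_distr h_def[symmetric]) (simp add: h_def)
  also have "distr M (borel \<Otimes>\<^sub>M S) (\<lambda>\<omega>. (V \<omega>, Y \<omega>)) = distr M borel V \<Otimes>\<^sub>M S"
    using ind by (simp add: independent_pair_def Y)
  also have "(\<integral>\<^sup>+p. h p \<partial>(distr M borel V \<Otimes>\<^sub>M S)) = (\<integral>\<^sup>+x. \<integral>\<^sup>+s. h (x, s) \<partial>S \<partial>distr M borel V)"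
    by (rule S.nn_integral_fst[symmetric]) (simp cong: measurable_cong_sets sets_pair_measure_cong)
  also have "\<dots> \<le> (\<integral>\<^sup>+x. ennreal (\<delta> * (norm x)\<^sup>2) \<partial>distr M borel V)"
    by (intro nn_integral_mono cond)
  also have "\<dots> = (\<integral>\<^sup>+\<omega>. ennreal (\<delta> * (norm (V \<omega>))\<^sup>2) \<partial>M)"
    by (simp add: nn_integral_distr)
  also have "\<dots> = ennreal (\<delta> * (\<integral>\<omega>. (norm (V \<omega>))\<^sup>2 \<partial>M))"
    using V \<open>0 \<le> \<delta>\<close> by (subst nn_integral_eq_integral) (auto simp: square_integrable_def)
  finally have bound: "(\<integral>\<^sup>+\<omega>. ennreal ((norm (Q (V \<omega>) (Y \<omega>) - V \<omega>))\<^sup>2) \<partial>M)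
      \<le> ennreal (\<delta> * (\<integral>\<omega>. (norm (V \<omega>))\<^sup>2 \<partial>M))" .
  have "integrable M (\<lambda>\<omega>. (norm (Q (V \<omega>) (Y \<omega>) - V \<omega>))\<^sup>2)"
    by (rule integrableI_nonneg) (use meas bound in \<open>auto intro: le_less_trans\<close>)
  then show "square_integrable M (\<lambda>\<omega>. Q (V \<omega>) (Y \<omega>) - V \<omega>)"
    and "(\<integral>\<omega>. (norm (Q (V \<omega>) (Y \<omega>) - V \<omega>))\<^sup>2 \<partial>M) \<le> \<delta> * (\<integral>\<omega>. (norm (V \<omega>))\<^sup>2 \<partial>M)"
    using meas bound \<open>0 \<le> \<delta>\<close> by (auto simp: square_integrable_def nn_integral_eq_integral)
qed

text \<open>
  The squared Frobenius norm is a sum over rows, so linearity of expectation suffices. What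
  matters is the joint law of one row and its own seed.
\<close>

lemma (in prob_space) compress_rows_mean_square_error:
  fixes V :: "'a \<Rightarrow> real ^ 'd ^ 'n"
  assumes Q: "compressor S Q \<delta>" and "0 \<le> \<delta>"
    and ind: "\<And>i. independent_pair borel (\<lambda>\<omega>. V \<omega> $ i) S (Y i)" and Y: "\<And>i. distr M S (Y i) = S"
    and V: "square_integrable M V"
  shows "square_integrable M (\<lambda>\<omega>. compress_rows Q (\<lambda>i. Y i \<omega>) (V \<omega>) - V \<omega>)"
    and "(\<integral>\<omega>. (norm (compress_rows Q (\<lambda>i. Y i \<omega>) (V \<omega>) - V \<omega>))\<^sup>2 \<partial>M)
      \<le> \<delta> * (\<integral>\<omega>. (norm (V \<omega>))\<^sup>2 \<partial>M)"
proof -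
  have rows: "(norm (Z :: real ^ 'd ^ 'n))\<^sup>2 = (\<Sum>i\<in>UNIV. (norm (Z $ i))\<^sup>2)" for Z
    unfolding power2_norm_eq_inner by (rule inner_vec_def)
  have Vi: "square_integrable M (\<lambda>\<omega>. V \<omega> $ i)" for i
    using square_integrable_linear[OF _ V, of "\<lambda>v. v $ i"]
    by (simp add: bounded_linear.linear[OF bounded_linear_vec_nth])
  note row = compressor_mean_square_error[OF Q \<open>0 \<le> \<delta>\<close> ind Y Vi]
  have eq: "compress_rows Q (\<lambda>i. Y i \<omega>) (V \<omega>) - V \<omega> = (\<chi> i. Q (V \<omega> $ i) (Y i \<omega>) - V \<omega> $ i)" for \<omega>
    by (simp add: compress_rows_def vec_eq_iff)
  show "square_integrable M (\<lambda>\<omega>. compress_rows Q (\<lambda>i. Y i \<omega>) (V \<omega>) - V \<omega>)"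
    using row(1) unfolding eq square_integrable_def rows
    by (auto intro!: borel_measurable_vec_lambda)
  have "(\<integral>\<omega>. (norm (compress_rows Q (\<lambda>i. Y i \<omega>) (V \<omega>) - V \<omega>))\<^sup>2 \<partial>M)
      = (\<Sum>i\<in>UNIV. \<integral>\<omega>. (norm (Q (V \<omega> $ i) (Y i \<omega>) - V \<omega> $ i))\<^sup>2 \<partial>M)"
    using row(1) unfolding eq rows by (subst Bochner_Integration.integral_sum) (auto simp: square_integrable_def)
  also have "\<dots> \<le> (\<Sum>i\<in>UNIV. \<delta> * (\<integral>\<omega>. (norm (V \<omega> $ i))\<^sup>2 \<partial>M))"
    by (intro sum_mono row(2))
  also have "\<dots> = \<delta> * (\<integral>\<omega>. (norm (V \<omega>))\<^sup>2 \<partial>M)"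
    using Vi unfolding rows
    by (subst Bochner_Integration.integral_sum) (auto simp: square_integrable_def sum_distrib_left)
  finally show "(\<integral>\<omega>. (norm (compress_rows Q (\<lambda>i. Y i \<omega>) (V \<omega>) - V \<omega>))\<^sup>2 \<partial>M)
      \<le> \<delta> * (\<integral>\<omega>. (norm (V \<omega>))\<^sup>2 \<partial>M)" .
qed

text \<open>
  The state \<open>Z k\<close> is a measurable function \<open>g\<close> of the inputs before time \<open>k\<close>, and these are independent
  of the input at time \<open>k\<close>. The recursion is only known on \<open>space M\<close>, which is why the conclusion is
  transferred from \<open>g\<close> to \<open>Z k\<close> through equality of laws.
\<close>

lemma (in prob_space) recursive_state_indep_next_input:
  assumes ind: "indep_vars (\<lambda>_. S) \<zeta> UNIV" and F: "F \<in> measurable (N \<Otimes>\<^sub>M S) N"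
    and "z \<in> space N" and Z0: "\<And>\<omega>. \<omega> \<in> space M \<Longrightarrow> Z 0 \<omega> = z"
    and step: "\<And>k \<omega>. \<omega> \<in> space M \<Longrightarrow> Z (Suc k) \<omega> = F (Z k \<omega>, \<zeta> k \<omega>)"
  shows "independent_pair N (Z k) S (\<zeta> k)"
proof -
  let ?H = "\<lambda>k. Pi\<^sub>M {..<k} (\<lambda>_. S)"
  have "\<exists>g. g \<in> measurable (?H k) N \<and> (\<forall>\<omega>\<in>space M. Z k \<omega> = g (\<lambda>j\<in>{..<k}. \<zeta> j \<omega>))"
  proof (induction k)
    case 0
    show ?case using \<open>z \<in> space N\<close> Z0 by (intro exI[of _ "\<lambda>_. z"]) auto
  next
    case (Suc k)
    then obtain g where g [measurable]: "g \<in> measurable (?H k) N"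
      and Zg: "\<And>\<omega>. \<omega> \<in> space M \<Longrightarrow> Z k \<omega> = g (\<lambda>j\<in>{..<k}. \<zeta> j \<omega>)" by blast
    define g' where "g' = (\<lambda>h. F (g (restrict h {..<k}), h k))"
    have "(\<lambda>h. restrict h {..<k}) \<in> measurable (?H (Suc k)) (?H k)"
      by (rule measurable_restrict_subset) auto
    moreover have "(\<lambda>h. h k) \<in> measurable (?H (Suc k)) S"
      by (rule measurable_component_singleton) auto
    ultimately have "g' \<in> measurable (?H (Suc k)) N"
      unfolding g'_def by (intro measurable_compose[OF _ F] measurable_Pair measurable_compose[OF _ g])
    moreover have "Z (Suc k) \<omega> = g' (\<lambda>j\<in>{..<Suc k}. \<zeta> j \<omega>)" if "\<omega> \<in> space M" for \<omega>
    proof -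
      have "restrict (\<lambda>j\<in>{..<Suc k}. \<zeta> j \<omega>) {..<k} = (\<lambda>j\<in>{..<k}. \<zeta> j \<omega>)"
        by (auto simp: restrict_def)
      then show ?thesis using step[OF that] Zg[OF that] by (simp add: g'_def)
    qed
    ultimately show ?case by blast
  qed
  then obtain g where g: "g \<in> measurable (?H k) N"
    and Zg: "\<And>\<omega>. \<omega> \<in> space M \<Longrightarrow> Z k \<omega> = g (\<lambda>j\<in>{..<k}. \<zeta> j \<omega>)" by blast
  have "indep_var (?H k) (\<lambda>\<omega>. \<lambda>j\<in>{..<k}. \<zeta> j \<omega>) (Pi\<^sub>M {k} (\<lambda>_. S)) (\<lambda>\<omega>. \<lambda>j\<in>{k}. \<zeta> j \<omega>)"
    by (rule indep_var_restrict[OF ind]) auto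
  then have "independent_pair (?H k) (\<lambda>\<omega>. \<lambda>j\<in>{..<k}. \<zeta> j \<omega>) (Pi\<^sub>M {k} (\<lambda>_. S)) (\<lambda>\<omega>. \<lambda>j\<in>{k}. \<zeta> j \<omega>)"
    unfolding independent_pair_def indep_var_distribution_eq by blast
  from independent_pair_compose[OF this g measurable_component_singleton[of k]]
  have "independent_pair N (\<lambda>\<omega>. g (\<lambda>j\<in>{..<k}. \<zeta> j \<omega>)) S (\<zeta> k)" by simp
  moreover have "distr M N (Z k) = distr M N (\<lambda>\<omega>. g (\<lambda>j\<in>{..<k}. \<zeta> j \<omega>))"
    "distr M (N \<Otimes>\<^sub>M S) (\<lambda>\<omega>. (Z k \<omega>, \<zeta> k \<omega>)) = distr M (N \<Otimes>\<^sub>M S) (\<lambda>\<omega>. (g (\<lambda>j\<in>{..<k}. \<zeta> j \<omega>), \<zeta> k \<omega>))"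
    "Z k \<in> measurable M N \<longleftrightarrow> (\<lambda>\<omega>. g (\<lambda>j\<in>{..<k}. \<zeta> j \<omega>)) \<in> measurable M N"
    by (auto intro!: distr_cong measurable_cong simp: Zg)
  ultimately show ?thesis unfolding independent_pair_def by simp
qed

section \<open>Convergence of compressed gossip\<close>

theorem theorem1:
  fixes E :: "('n::finite \<times> 'n) set" and W :: "real ^ 'n ^ 'n"
    and M :: "'w measure" and S :: "'s measure" and \<xi> :: "nat \<Rightarrow> 'n \<Rightarrow> 'w \<Rightarrow> 's"
    and Q :: "real ^ 'd::finite \<Rightarrow> 's \<Rightarrow> real ^ 'd"
    and x :: "'n \<Rightarrow> real ^ 'd"
    and X Xhat :: "nat \<Rightarrow> 'w \<Rightarrow> real ^ 'd ^ 'n"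
    and \<delta> \<gamma> :: real
  defines "lam2 \<equiv> nth_largest_eigenvalue W 2"
    and "lamn \<equiv> nth_largest_eigenvalue W CARD('n)"
  defines "\<rho> \<equiv> 1 - lam2"
  defines "q \<equiv> (1 + \<gamma> * (1 - lamn)) * \<delta> / (1 - \<gamma> * (1 - lamn))"
    and "\<sigma> \<equiv> max (1 - 2 * \<gamma> * \<rho> / (1 + \<gamma> * (1 - lamn)))
                  (\<delta> * (1 + \<gamma> * (1 - lamn)) / (1 - \<gamma> * (1 - lamn)))"
    and "xbar \<equiv> (1 / real CARD('n)) *\<^sub>R (\<Sum>i\<in>UNIV. x i)"
  defines "err \<equiv> \<lambda>k \<omega>. q * (norm (X k \<omega> - outer_product 1 xbar))\<^sup>2
                       + (norm (Xhat (Suc k) \<omega> - X k \<omega>))\<^sup>2"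
  defines "e \<equiv> \<lambda>k. \<integral>\<omega>. err k \<omega> \<partial>M"
  assumes "CARD('n) \<ge> 2"
    and "network_weights E W"
    and "0 \<le> \<delta>" and "\<delta> < 1"
    and "compressor S Q \<delta>"
    and "iteration_seeds M S \<xi>"
    and "\<And>\<omega>. \<omega> \<in> space M \<Longrightarrow> X 0 \<omega> = (\<chi> i. x i)"
    and "\<And>\<omega>. \<omega> \<in> space M \<Longrightarrow> Xhat 0 \<omega> = 0"
    and "\<And>k \<omega>. \<omega> \<in> space M \<Longrightarrow>
           Xhat (Suc k) \<omega> = Xhat k \<omega> + compress_rows Q (\<lambda>i. \<xi> k i \<omega>) (X k \<omega> - Xhat k \<omega>)"
    and "\<And>k \<omega>. \<omega> \<in> space M \<Longrightarrow>
           X (Suc k) \<omega> = X k \<omega> + \<gamma> *\<^sub>R ((W - mat 1) ** Xhat (Suc k) \<omega>)"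
    and "\<gamma> \<in> {0 <..< (1 - \<delta>) / ((1 + \<delta>) * (1 - lamn))}"
  shows "(\<forall>k. integrable M (err k)) \<and>
         (\<forall>k. e (Suc k) \<le> \<sigma> * e k) \<and>
         \<sigma> < 1 \<and>
         (\<gamma> = (1 - \<delta>) / ((3 + \<delta>) * (1 - lamn)) \<longrightarrow>
            \<sigma> = 1 - (1 - \<delta>) * \<rho> / (2 * (1 - lamn)))"
proof -
  interpret prob_space M using \<open>iteration_seeds M S \<xi>\<close> by (simp add: iteration_seeds_def)
  note X_0 = assms(15) and Xhat_0 = assms(16) and Xhat_Suc = assms(17) and X_Suc = assms(18)
  have W: "transpose W = W" "null_space (mat 1 - W) = span {1}" "loewner_le W (mat 1)"
    using \<open>network_weights E W\<close> by (simp_all add: network_weights_def)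
  note spectrum = network_matrix_spectrum[OF \<open>2 \<le> CARD('n)\<close> W, folded lam2_def lamn_def]
  note form = network_quadratic_form_bounds[OF \<open>2 \<le> CARD('n)\<close> W, folded lam2_def lamn_def]
  define \<tau> where "\<tau> = \<gamma> * (1 - lamn)"
  have lam: "0 < 1 - lamn" "0 < \<rho>" "\<rho> \<le> 1 - lamn" using spectrum(1,2) by (simp_all add: \<rho>_def)
  have \<gamma>: "0 < \<gamma>" "\<gamma> < (1 - \<delta>) / ((1 + \<delta>) * (1 - lamn))" using assms(19) by auto
  have \<tau>: "0 < \<tau>" "\<tau> * (1 + \<delta>) < 1 - \<delta>"
    using \<gamma> lam \<open>0 \<le> \<delta>\<close> by (simp_all add: \<tau>_def pos_less_divide_eq mult_ac)
  have "\<tau> \<le> \<tau> * (1 + \<delta>)" using \<tau>(1) \<open>0 \<le> \<delta>\<close> by (simp add: algebra_simps)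
  then have "\<tau> < 1" using \<tau> \<open>0 \<le> \<delta>\<close> by linarith
  have q: "q = (1 + \<tau>) * \<delta> / (1 - \<tau>)" by (simp add: q_def \<tau>_def)
  have \<sigma>: "\<sigma> = max (1 - 2 * (\<gamma> * \<rho>) / (1 + \<tau>)) q"
    by (simp add: \<sigma>_def q_def \<tau>_def mult_ac)
  have "0 \<le> q" using \<tau> \<open>\<tau> < 1\<close> \<open>0 \<le> \<delta>\<close> by (simp add: q)
  have "q < 1" using \<tau> \<open>\<tau> < 1\<close> by (simp add: q divide_less_eq algebra_simps)
  have "\<sigma> < 1" using \<open>q < 1\<close> \<gamma>(1) lam \<tau>(1) by (simp add: \<sigma>)
  have special: "\<sigma> = 1 - (1 - \<delta>) * \<rho> / (2 * (1 - lamn))"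
    if "\<gamma> = (1 - \<delta>) / ((3 + \<delta>) * (1 - lamn))"
  proof -
    \<comment> \<open>For this step size \<open>q = 2 * \<delta> / (1 + \<delta>)\<close>, and since \<open>\<rho> \<le> 1 - lamn\<close> the first argument of
      the maximum is at least \<open>(1 + \<delta>) / 2\<close>, which is at least \<open>q\<close> by the inequality of arithmetic and
      geometric means.\<close>
    have t: "\<tau> = (1 - \<delta>) / (3 + \<delta>)" using lam by (simp add: \<tau>_def that)
    have t1: "1 + \<tau> = 4 / (3 + \<delta>)" "1 - \<tau> = 2 * (1 + \<delta>) / (3 + \<delta>)"
      using \<open>0 \<le> \<delta>\<close> by (simp_all add: t field_simps)
    have q': "q = 2 * \<delta> / (1 + \<delta>)"
      unfolding q t1 using \<open>0 \<le> \<delta>\<close> by (simp add: divide_simps)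
    have first: "2 * (\<gamma> * \<rho>) / (1 + \<tau>) = (1 - \<delta>) * \<rho> / (2 * (1 - lamn))"
      unfolding t1 that using \<open>0 \<le> \<delta>\<close> lam by (simp add: divide_simps)
    have "(1 - \<delta>) * \<rho> / (2 * (1 - lamn)) \<le> (1 - \<delta>) / 2"
      using lam \<open>\<delta> < 1\<close> by (simp add: divide_simps mult_left_mono)
    moreover have "2 * \<delta> / (1 + \<delta>) \<le> (1 + \<delta>) / 2"
    proof -
      have "4 * \<delta> \<le> (1 + \<delta>) * (1 + \<delta>)"
        using zero_le_power2[of "1 - \<delta>"] by (simp add: power2_eq_square algebra_simps)
      then show ?thesis using \<open>0 \<le> \<delta>\<close> by (simp add: divide_simps)
    qed
    ultimately have "q \<le> 1 - 2 * (\<gamma> * \<rho>) / (1 + \<tau>)" unfolding first q' by argo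
    then show ?thesis by (simp add: \<sigma> first)
  qed

  define T where "T = (\<lambda>Y :: real ^ 'd ^ 'n. \<gamma> *\<^sub>R ((mat 1 - W) ** Y))"
  have linT: "linear T" unfolding T_def
    by (intro linear_compose_scale_right linear_matrix_mult)
  have A1: "(mat 1 - W) *v 1 = 0"
  proof -
    have "(1 :: real ^ 'n) \<in> null_space (mat 1 - W)" unfolding W(2) by (simp add: span_base)
    then show ?thesis by (simp add: null_space_def)
  qed
  define C :: "real ^ 'd ^ 'n" where "C = outer_product 1 xbar"
  have TC: "T C = 0"
  proof -
    have "column j ((mat 1 - W) ** C) = 0" for j
      by (simp add: column_matrix_mult C_def outer_product_one_column matrix_vector_mult_scaleR A1)
    then show ?thesis by (simp add: T_def vec_eq_iff column_def)
  qed
  have Tcol: "column j (T Y) \<bullet> 1 = 0" for j Y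
  proof -
    have "((mat 1 - W) *v column j Y) \<bullet> 1 = column j Y \<bullet> ((mat 1 - W) *v 1)"
      by (simp add: matrix_vector_mult_diff_rdistrib inner_diff_left inner_diff_right
          symmetric_matrix_selfadjoint[OF W(1)])
    then show ?thesis
      by (simp add: T_def A1 column_matrix_mult[symmetric] column_scaleR)
  qed

  define H where "H = (\<lambda>k \<omega>. Xhat (Suc k) \<omega> - X k \<omega>)"
  define D where "D = (\<lambda>k \<omega>. X k \<omega> - C)"
  define V where "V = (\<lambda>k \<omega>. X k \<omega> - Xhat k \<omega>)"
  have Xstep: "X (Suc k) \<omega> = X k \<omega> - T (Xhat (Suc k) \<omega>)" if "\<omega> \<in> space M" for k \<omega>
  proof -
    have "(W - mat 1) ** Y = - ((mat 1 - W) ** Y)" for Y :: "real ^ 'd ^ 'n"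
      by (simp add: vec_eq_iff matrix_matrix_mult_def sum_negf[symmetric] algebra_simps)
    then show ?thesis using X_Suc[OF that] by (simp add: T_def)
  qed
  have H: "H k \<omega> = compress_rows Q (\<lambda>i. \<xi> k i \<omega>) (V k \<omega>) - V k \<omega>" if "\<omega> \<in> space M" for k \<omega>
    using Xhat_Suc[OF that] by (simp add: H_def V_def)
  have hat: "Xhat (Suc k) \<omega> = C + (D k \<omega> + H k \<omega>)" for k \<omega> by (simp add: D_def H_def)
  \<comment> \<open>Both the new disagreement and the new input of the compressor are expressed by the old
    disagreement and compression error, because \<open>T\<close> annihilates the consensus matrix \<open>C\<close>.\<close>
  have Dstep: "D (Suc k) \<omega> = D k \<omega> - T (D k \<omega> + H k \<omega>)"
    and Vstep: "V (Suc k) \<omega> = - (H k \<omega> + T (D k \<omega> + H k \<omega>))" if "\<omega> \<in> space M" for k \<omega>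
  proof -
    have "T (Xhat (Suc k) \<omega>) = T (D k \<omega> + H k \<omega>)"
      unfolding hat by (simp only: linear_add[OF linT, of C] TC add_0_left)
    then show "D (Suc k) \<omega> = D k \<omega> - T (D k \<omega> + H k \<omega>)"
      "V (Suc k) \<omega> = - (H k \<omega> + T (D k \<omega> + H k \<omega>))"
      using Xstep[OF that, of k] by (simp_all add: D_def V_def H_def)
  qed
  \<comment> \<open>The average of the rows is conserved, so the spectral gap applies to the disagreement.\<close>
  have Dcol: "column j (D k \<omega>) \<bullet> 1 = 0" if "\<omega> \<in> space M" for j k \<omega>
  proof (induction k)
    case 0
    have "column j (D 0 \<omega>) = (\<chi> i. x i $ j - xbar $ j)"
      using X_0[OF that] by (simp add: D_def C_def vec_eq_iff column_def outer_product_def)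
    then show ?case by (simp add: inner_vec_def sum_subtractf xbar_def)
  next
    case (Suc k)
    have "column j (D (Suc k) \<omega>) = column j (D k \<omega>) - column j (T (D k \<omega> + H k \<omega>))"
      by (simp add: Dstep[OF that] vec_eq_iff column_def)
    then show ?case using Suc by (simp add: inner_diff_left Tcol)
  qed
  have lyapunov: "q * (norm (D (Suc k) \<omega>))\<^sup>2 + \<delta> * (norm (V (Suc k) \<omega>))\<^sup>2 \<le> \<sigma> * err k \<omega>"
    if "\<omega> \<in> space M" for k \<omega>
  proof -
    have "q * (norm (D (Suc k) \<omega>))\<^sup>2 + \<delta> * (norm (V (Suc k) \<omega>))\<^sup>2
        \<le> q * (1 - 2 * (\<gamma> * \<rho>) / (1 + \<tau>)) * (norm (D k \<omega>))\<^sup>2 + q * (norm (H k \<omega>))\<^sup>2"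
      unfolding Dstep[OF that] Vstep[OF that] norm_minus_cancel q
    proof (rule lyapunov_step[OF linT])
      show "T v \<bullet> w = v \<bullet> T w" for v w by (simp add: T_def form(1))
      show "0 \<le> T v \<bullet> v" for v using form(2)[of v] \<gamma>(1) by (simp add: T_def)
      show "T v \<bullet> v \<le> \<tau> * (norm v)\<^sup>2" for v
        using mult_left_mono[OF form(3)[of v], of \<gamma>] \<gamma>(1) by (simp add: T_def \<tau>_def mult.assoc)
      show "\<gamma> * \<rho> * (norm (D k \<omega>))\<^sup>2 \<le> T (D k \<omega>) \<bullet> D k \<omega>"
        using mult_left_mono[OF form(4)[OF Dcol[OF that]], of \<gamma>] \<gamma>(1) by (simp add: T_def \<rho>_def mult.assoc)
    qed (use \<tau> \<open>\<tau> < 1\<close> \<open>0 \<le> \<delta>\<close> in simp_all)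
    also have "\<dots> \<le> q * \<sigma> * (norm (D k \<omega>))\<^sup>2 + \<sigma> * (norm (H k \<omega>))\<^sup>2"
      using \<open>0 \<le> q\<close> by (intro add_mono mult_right_mono mult_left_mono) (simp_all add: \<sigma>)
    also have "\<dots> = \<sigma> * err k \<omega>" by (simp add: err_def D_def H_def C_def algebra_simps)
    finally show ?thesis .
  qed

  let ?seeds = "Pi\<^sub>M UNIV (\<lambda>i :: 'n. S)"
  let ?N = "borel \<Otimes>\<^sub>M borel :: ((real ^ 'd ^ 'n) \<times> (real ^ 'd ^ 'n)) measure"
  have seeds: "indep_vars (\<lambda>k. ?seeds) (\<lambda>k \<omega> i. \<xi> k i \<omega>) UNIV" "\<And>k i. distr M S (\<xi> k i) = S"
    using \<open>iteration_seeds M S \<xi>\<close> by (simp_all add: iteration_seeds_def)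
  \<comment> \<open>One iteration as a measurable map of the pair of iterates and the vector of seeds; it makes the
    compressor input independent of the seeds that compress it.\<close>
  define hat' where "hat' = (\<lambda>p :: ((real ^ 'd ^ 'n) \<times> (real ^ 'd ^ 'n)) \<times> ('n \<Rightarrow> 's).
    snd (fst p) + compress_rows Q (snd p) (fst (fst p) - snd (fst p)))"
  define F where "F = (\<lambda>p. (fst (fst p) - T (hat' p), hat' p))"
  have Tm: "T \<in> borel_measurable borel"
    using linT by (intro borel_measurable_continuous_onI linear_continuous_on) (simp add: linear_conv_bounded_linear)
  have Qm: "(\<lambda>p. Q (fst p) (snd p)) \<in> borel_measurable (borel \<Otimes>\<^sub>M S)"
    using \<open>compressor S Q \<delta>\<close> by (simp add: compressor_def case_prod_beta')
  have "(\<lambda>p. Q ((fst (fst p) - snd (fst p)) $ i) (snd p i)) \<in> borel_measurable (?N \<Otimes>\<^sub>M ?seeds)" for i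
  proof -
    have "(\<lambda>p. fst (fst p) - snd (fst p)) \<in> borel_measurable (?N \<Otimes>\<^sub>M ?seeds)" by measurable
    then have a: "(\<lambda>p. (fst (fst p) - snd (fst p)) $ i) \<in> borel_measurable (?N \<Otimes>\<^sub>M ?seeds)"
      by (rule measurable_compose[OF _ borel_measurable_vec_nth])
    have b: "(\<lambda>p. snd p i) \<in> measurable (?N \<Otimes>\<^sub>M ?seeds) S"
      by (rule measurable_compose[OF measurable_snd measurable_component_singleton]) simp
    show ?thesis using measurable_compose[OF measurable_Pair[OF a b] Qm] by simp
  qed
  then have "(\<lambda>p. compress_rows Q (snd p) (fst (fst p) - snd (fst p))) \<in> borel_measurable (?N \<Otimes>\<^sub>M ?seeds)"
    unfolding compress_rows_def by (rule borel_measurable_vec_lambda)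
  then have hm: "hat' \<in> borel_measurable (?N \<Otimes>\<^sub>M ?seeds)" unfolding hat'_def by measurable
  have Fm: "F \<in> measurable (?N \<Otimes>\<^sub>M ?seeds) ?N"
    unfolding F_def using hm measurable_compose[OF hm Tm] by (intro measurable_Pair borel_measurable_diff) measurable
  have state: "independent_pair ?N (\<lambda>\<omega>. (X k \<omega>, Xhat k \<omega>)) ?seeds (\<lambda>\<omega> i. \<xi> k i \<omega>)" for k
  proof (rule recursive_state_indep_next_input[where Z = "\<lambda>k \<omega>. (X k \<omega>, Xhat k \<omega>)", OF seeds(1) Fm])
    show "((\<chi> i. x i), 0) \<in> space ?N" by (simp add: space_pair_measure)
    show "(X 0 \<omega>, Xhat 0 \<omega>) = ((\<chi> i. x i), 0)" if "\<omega> \<in> space M" for \<omega>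
      using X_0[OF that] Xhat_0[OF that] by simp
    show "(X (Suc k) \<omega>, Xhat (Suc k) \<omega>) = F ((X k \<omega>, Xhat k \<omega>), \<lambda>i. \<xi> k i \<omega>)"
      if "\<omega> \<in> space M" for k \<omega>
      using Xstep[OF that, of k] Xhat_Suc[OF that, of k] by (simp add: F_def hat'_def)
  qed
  have rows: "independent_pair borel (\<lambda>\<omega>. V k \<omega> $ i) S (\<xi> k i)" for k i
  proof -
    have "(\<lambda>z. (fst z - snd z) $ i) \<in> borel_measurable ?N"
      by (rule measurable_compose[OF _ borel_measurable_vec_nth]) measurable
    from independent_pair_compose[OF state this measurable_component_singleton[of i]]
    show ?thesis by (simp add: o_def V_def)
  qed
  note error = compress_rows_mean_square_error[OF \<open>compressor S Q \<delta>\<close> \<open>0 \<le> \<delta>\<close> rows seeds(2)]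
  have Hint: "square_integrable M (H k)" if "square_integrable M (V k)" for k
    using error(1)[OF that] by (subst square_integrable_cong[OF H])
  have XXint: "square_integrable M (X k) \<and> square_integrable M (Xhat k)" for k
  proof (induction k)
    case 0
    show ?case using X_0 Xhat_0
      by (simp add: square_integrable_const cong: square_integrable_cong)
  next
    case (Suc k)
    then have "square_integrable M (H k)" unfolding V_def by (intro Hint) (simp add: V_def square_integrable_diff)
    then have "square_integrable M (\<lambda>\<omega>. H k \<omega> + X k \<omega>)" using Suc by (intro square_integrable_add) auto
    then have hatint: "square_integrable M (Xhat (Suc k))" by (simp add: H_def)
    have "square_integrable M (\<lambda>\<omega>. X k \<omega> - T (Xhat (Suc k) \<omega>))"
      using Suc by (intro square_integrable_diff square_integrable_linear[OF linT] hatint) auto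
    then show ?case using hatint by (subst square_integrable_cong[OF Xstep]) auto
  qed
  have Dint: "integrable M (\<lambda>\<omega>. (norm (D k \<omega>))\<^sup>2)"
    and Vsq: "square_integrable M (V k)" for k
    using XXint[of k] square_integrable_diff[OF _ square_integrable_const, of "X k" C]
      square_integrable_diff[of M "X k" "Xhat k"]
    by (simp_all add: square_integrable_def D_def V_def)
  have Hi: "integrable M (\<lambda>\<omega>. (norm (H k \<omega>))\<^sup>2)" and Vi: "integrable M (\<lambda>\<omega>. (norm (V k \<omega>))\<^sup>2)" for k
    using Hint[OF Vsq] Vsq by (simp_all add: square_integrable_def)
  have HV: "(\<integral>\<omega>. (norm (H k \<omega>))\<^sup>2 \<partial>M) \<le> \<delta> * (\<integral>\<omega>. (norm (V k \<omega>))\<^sup>2 \<partial>M)" for k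
    using error(2)[OF Vsq] by (simp add: H cong: Bochner_Integration.integral_cong)
  have err: "err k = (\<lambda>\<omega>. q * (norm (D k \<omega>))\<^sup>2 + (norm (H k \<omega>))\<^sup>2)" for k
    by (simp add: err_def D_def H_def C_def)
  have errint: "integrable M (err k)" for k unfolding err using Dint Hi by simp
  \<comment> \<open>Averaging over the fresh seeds replaces the new compression error by \<open>\<delta>\<close> times the squared
    compressor input, after which the Lyapunov inequality holds pointwise.\<close>
  have "e (Suc k) \<le> \<sigma> * e k" for k
  proof -
    have "e (Suc k) = q * (\<integral>\<omega>. (norm (D (Suc k) \<omega>))\<^sup>2 \<partial>M) + (\<integral>\<omega>. (norm (H (Suc k) \<omega>))\<^sup>2 \<partial>M)"
      using Dint Hi by (simp add: e_def err)
    also have "\<dots> \<le> q * (\<integral>\<omega>. (norm (D (Suc k) \<omega>))\<^sup>2 \<partial>M) + \<delta> * (\<integral>\<omega>. (norm (V (Suc k) \<omega>))\<^sup>2 \<partial>M)"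
      using HV by simp
    also have "\<dots> = (\<integral>\<omega>. q * (norm (D (Suc k) \<omega>))\<^sup>2 + \<delta> * (norm (V (Suc k) \<omega>))\<^sup>2 \<partial>M)"
      using Dint Vi by simp
    also have "\<dots> \<le> (\<integral>\<omega>. \<sigma> * err k \<omega> \<partial>M)"
      using Dint Vi errint by (intro integral_mono lyapunov) auto
    finally show ?thesis by (simp add: e_def)
  qed
  then show ?thesis using errint \<open>\<sigma> < 1\<close> special by blast
qed

end
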